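(* Let $\Gamma\subset\mathbb{R}^2$ be an ellipse. The set of incenters (centers of the inscribed circles) of all triangular orbits of the billiard inside $\Gamma$ is an ellipse.
   Context: The billiard in an ellipse $\Gamma\subset\mathbb{R}^2$ is the dynamical system in which a point moves along straight segments inside $\Gamma$ and reflects at $\Gamma$ by the standard law: the angle of incidence equals the angle of reflection with respect to the tangent line of $\Gamma$ at the reflection point. A triangular orbit (3-periodic orbit) is a non-degenerate triangle with vertices on $\Gamma$ such that at each vertex the two sides of the triangle meeting there satisfy the reflection law, i.e. they are exchanged by the Euclidean reflection in the tangent line to $\Gamma$ at that vertex. The incenter of a triangle is the center of its inscribed circle. Convention: if $\Gamma$ is a circle, the set of incenters is a single point, which is regarded as a (degenerate) ellipse; if $\Gamma$ is not a circle, "ellipse" has its usual, non-degenerate meaning (a circle being a special case of an ellipse). *)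

theory Defs
  imports "HOL-Analysis.Analysis"
begin

text \<open>Standard equation of an ellipse with centre \<open>c\<close> and semi-axes \<open>a\<close>, \<open>b\<close> in the orthonormal
  frame \<open>u\<close>, \<open>v\<close>. The semi-axes are positive but not ordered, and circles (\<open>a = b\<close>) are included.\<close>

definition is_ellipse :: "(real^2) set \<Rightarrow> bool" where
  "is_ellipse S \<longleftrightarrow>
     (\<exists>c u v a b. norm u = 1 \<and> norm v = 1 \<and> u \<bullet> v = 0 \<and> 0 < a \<and> 0 < b \<and>
        S = {p. ((p - c) \<bullet> u)\<^sup>2 / a\<^sup>2 + ((p - c) \<bullet> v)\<^sup>2 / b\<^sup>2 = 1})"

definition is_circle :: "(real^2) set \<Rightarrow> bool" where
  "is_circle S \<longleftrightarrow> (\<exists>c r. 0 < r \<and> S = sphere c r)"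

text \<open>The points \<open>P + w\<close>, where \<open>w\<close> is the velocity at \<open>P\<close> of a path lying in \<open>S\<close>. Nothing is
  assumed about \<open>\<gamma>\<close> away from time 0, so letting it be defined for all times is no restriction.\<close>

definition tangent_line :: "(real^2) set \<Rightarrow> real^2 \<Rightarrow> (real^2) set" where
  "tangent_line S P =
     {P + w | w. \<exists>\<gamma> :: real \<Rightarrow> real^2.
        range \<gamma> \<subseteq> S \<and> \<gamma> 0 = P \<and> (\<gamma> has_vector_derivative w) (at 0)}"

definition reflection_in :: "(real^2) set \<Rightarrow> real^2 \<Rightarrow> real^2" where
  "reflection_in L x = 2 *\<^sub>R closest_point L x - x"

text \<open>The lines \<open>PQ\<close> and \<open>PR\<close> are exchanged by the reflection in the tangent at \<open>P\<close>; the reflection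
  is an involution, so this single equation suffices. It has to be the lines and not the
  segments, which lie on the same side of the tangent.\<close>

definition reflection_law :: "(real^2) set \<Rightarrow> real^2 \<Rightarrow> real^2 \<Rightarrow> real^2 \<Rightarrow> bool" where
  "reflection_law S P Q R \<longleftrightarrow>
     reflection_in (tangent_line S P) ` (affine hull {P, Q}) = affine hull {P, R}"

definition triangular_orbit :: "(real^2) set \<Rightarrow> real^2 \<Rightarrow> real^2 \<Rightarrow> real^2 \<Rightarrow> bool" where
  "triangular_orbit S A B C \<longleftrightarrow>
     \<not> collinear {A, B, C} \<and> A \<in> S \<and> B \<in> S \<and> C \<in> S \<and>
     reflection_law S A B C \<and> reflection_law S B C A \<and> reflection_law S C A B"

text \<open>The point of contact is required to lie on the side itself and not just on its extension;
  this excludes the excircles.\<close>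

definition touches_side :: "(real^2) set \<Rightarrow> real^2 \<Rightarrow> real^2 \<Rightarrow> bool" where
  "touches_side K A B \<longleftrightarrow>
     (\<exists>T \<in> K \<inter> closed_segment A B. tangent_line K T = affine hull {A, B})"

definition is_incenter :: "real^2 \<Rightarrow> real^2 \<Rightarrow> real^2 \<Rightarrow> real^2 \<Rightarrow> bool" where
  "is_incenter p A B C \<longleftrightarrow>
     (\<exists>r>0. touches_side (sphere p r) A B \<and> touches_side (sphere p r) B C \<and>
        touches_side (sphere p r) C A)"

definition incenters :: "(real^2) set \<Rightarrow> (real^2) set" where
  "incenters S = {p. \<exists>A B C. triangular_orbit S A B C \<and> is_incenter p A B C}"

end

theory Submission
  imports Defs "HOL-Computational_Algebra.Fundamental_Theorem_Algebra"
begin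

text \<open>
  Parametrize the ellipse with semi-axes \<open>a\<close>, \<open>b\<close> by the unit circle in the complex plane, \<open>z\<close> going
  to the point with coordinates \<open>(a * Re z, b * Im z)\<close>, and put \<open>D = a\<^sup>2 - b\<^sup>2\<close>, \<open>S = a\<^sup>2 + b\<^sup>2\<close>. Because of
  \<open>cnj z = 1 / z\<close>, conditions on three points \<open>z1\<close>, \<open>z2\<close>, \<open>z3\<close> become polynomial equations, and the
  triangle enters them through the elementary symmetric functions \<open>s1\<close>, \<open>s2\<close>, \<open>s3\<close> of its vertices.

  \<^item> The reflection law at a vertex says that a polynomial of degree at most 5, the same for all three
    vertices, vanishes there (\<open>reflection_law_iff_poly\<close>, \<open>three_reflections_iff\<close>). Divisibility by the cubic with
    zeros \<open>z1\<close>, \<open>z2\<close>, \<open>z3\<close> amounts to \<open>s1 = s2 * s3\<close> together with an equation for \<open>s2\<close> alone,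
    which has only one root of modulus at most 3 (\<open>orbit_const_unique\<close>). So \<open>s2 = - \<mu>\<close> is the same real
    number for all billiard triangles, \<open>\<bar>\<mu>\<bar> < 1\<close>, and only the unimodular number \<open>s3\<close> is free.

  \<^item> It is indeed free: the cubic with \<open>s1 = - \<mu> * s3\<close> and \<open>s2 = - \<mu>\<close> is the equation \<open>B z = s3\<close> for a
    Blaschke product \<open>B\<close> of degree 3, and has three distinct zeros on the unit circle
    (\<open>unimodular_triple_exists\<close>).

  \<^item> By the reflection law the angle bisectors of the triangle are the normals of the ellipse at the
    vertices, so the incenter is the point where these three normals meet (\<open>incenter_on_normals\<close>). The
    normals through \<open>(X, Y)\<close> have their feet at the zeros of a quartic; dividing it by the cubic gives
    \<open>2 * (a * X - \<i> * b * Y) = D * (s1 - 1 / s3) = - D * (\<mu> * s3 + cnj s3)\<close> (\<open>normals_concurrent\<close>).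

  As \<open>s3\<close> runs through the unit circle, \<open>(X, Y)\<close> runs through an ellipse with semi-axes
  \<open>\<bar>D\<bar> * (1 + \<mu>) / (2 * a)\<close> and \<open>\<bar>D\<bar> * (1 - \<mu>) / (2 * b)\<close>, which shrinks to the centre exactly if \<open>D = 0\<close>.
\<close>

section \<open>Reflections in lines of the plane\<close>

lemma orthonormal_expansion:
  fixes u v w :: "real^2"
  assumes "norm u = 1" "norm v = 1" "u \<bullet> v = 0"
  shows "w = (w \<bullet> u) *\<^sub>R u + (w \<bullet> v) *\<^sub>R v"
proof -
  have nz: "u \<noteq> v" "u \<noteq> 0" "v \<noteq> 0" using assms by auto
  have po: "pairwise orthogonal {u, v}"
    using assms by (auto simp: pairwise_def orthogonal_def inner_commute)
  have ind: "independent {u, v}"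
    by (rule pairwise_orthogonal_independent[OF po]) (use nz in auto)
  have "span {u, v} = UNIV"
    using card_ge_dim_independent[of "{u,v}" UNIV] ind nz by auto
  then show ?thesis
    using orthonormal_basis_expand[OF po, of w] assms nz by force
qed

lemma orthonormal_inner_self:
  fixes u v w :: "real^2"
  assumes "norm u = 1" "norm v = 1" "u \<bullet> v = 0"
  shows "w \<bullet> w = (w \<bullet> u)\<^sup>2 + (w \<bullet> v)\<^sup>2"
  using arg_cong[OF orthonormal_expansion[OF assms, of w], of "\<lambda>x. w \<bullet> x"]
  by (simp add: inner_add_right power2_eq_square)

lemma eq_zero_if_orthogonal_to_two:
  fixes n t x :: "real^2"
  assumes "n \<noteq> 0" "t \<noteq> 0" "n \<bullet> t = 0" "x \<bullet> n = 0" "x \<bullet> t = 0"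
  shows "x = 0"
  using orthonormal_expansion[of "sgn n" "sgn t" x] assms
  by (simp add: norm_sgn sgn_div_norm)

lemma parallel_if_det_zero:
  fixes n t d w :: "real^2"
  assumes nt: "n \<noteq> 0" "t \<noteq> 0" "n \<bullet> t = 0"
    and d: "d \<noteq> 0" and det: "(w \<bullet> n) * (d \<bullet> t) = (w \<bullet> t) * (d \<bullet> n)"
  obtains k where "w = k *\<^sub>R d"
proof (cases "d \<bullet> n = 0")
  case False
  have "w - (w \<bullet> n / (d \<bullet> n)) *\<^sub>R d = 0"
    by (rule eq_zero_if_orthogonal_to_two[OF nt])
      (use False det in \<open>auto simp: inner_diff_left field_simps\<close>)
  then show ?thesis using that by auto
next
  case True
  then have dt: "d \<bullet> t \<noteq> 0" using eq_zero_if_orthogonal_to_two[OF nt] d by auto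
  have "w - (w \<bullet> t / (d \<bullet> t)) *\<^sub>R d = 0"
    by (rule eq_zero_if_orthogonal_to_two[OF nt])
      (use True dt det in \<open>auto simp: inner_diff_left field_simps\<close>)
  then show ?thesis using that by auto
qed

text \<open>Subtracting from \<open>x\<close> its component along \<open>n\<close> gives the foot of the perpendicular, which by
  Cauchy-Schwarz is the closest point of the line; the reflection therefore negates that component.\<close>

lemma reflection_in_line:
  fixes P n x :: "real^2"
  assumes "n \<noteq> 0"
  shows "reflection_in {q. (q - P) \<bullet> n = 0} x = x - (2 * ((x - P) \<bullet> n) / (n \<bullet> n)) *\<^sub>R n"
proof -
  define L where "L = {q. (q - P) \<bullet> n = 0}"
  define k where "k = ((x - P) \<bullet> n) / (n \<bullet> n)"
  have L: "L = {q. n \<bullet> q = n \<bullet> P}"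
    by (auto simp: L_def inner_diff_left inner_diff_right inner_commute)
  have kn: "k * (n \<bullet> n) = (x - P) \<bullet> n" using assms by (simp add: k_def)
  have mem: "x - k *\<^sub>R n \<in> L"
    using kn by (simp add: L_def inner_diff_left)
  have near: "dist x (x - k *\<^sub>R n) \<le> dist x q" if "q \<in> L" for q
  proof -
    have "k * (n \<bullet> n) = (x - q) \<bullet> n"
      using kn that by (simp add: L_def inner_diff_left)
    then have "\<bar>k\<bar> * (norm n * norm n) \<le> norm (x - q) * norm n"
      using Cauchy_Schwarz_ineq2[of "x - q" n]
      by (simp add: dot_square_norm power2_eq_square flip: abs_mult)
    then show ?thesis using assms by (simp add: dist_norm flip: mult.assoc)
  qed
  have "x - k *\<^sub>R n = closest_point L x"
    by (rule closest_point_unique)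
      (use mem near in \<open>auto simp: L convex_hyperplane closed_hyperplane\<close>)
  then have "reflection_in L x = 2 *\<^sub>R (x - k *\<^sub>R n) - x"
    by (simp add: reflection_in_def)
  also have "\<dots> = x - (2 * k) *\<^sub>R n" by (simp add: algebra_simps scaleR_2)
  finally show ?thesis by (simp add: L_def k_def)
qed

text \<open>In an orthogonal frame \<open>t\<close>, \<open>n\<close> the reflection keeps the \<open>t\<close>-component of a direction and negates
  its \<open>n\<close>-component, so that the law says that two directions have a vanishing determinant. This
  turns the law into one equation, which is symmetric in the two sides.\<close>

lemma reflection_exchanges_lines_iff:
  fixes P Q R n t :: "real^2"
  assumes nt: "n \<noteq> 0" "t \<noteq> 0" "n \<bullet> t = 0" and "Q \<noteq> P" "R \<noteq> P"
  shows "reflection_in {q. (q - P) \<bullet> n = 0} ` (affine hull {P, Q}) = affine hull {P, R} \<longleftrightarrow>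
    ((Q - P) \<bullet> t) * ((R - P) \<bullet> n) + ((Q - P) \<bullet> n) * ((R - P) \<bullet> t) = 0"
proof -
  define w where "w = (Q - P) - (2 * ((Q - P) \<bullet> n) / (n \<bullet> n)) *\<^sub>R n"
  have wn: "w \<bullet> n = - ((Q - P) \<bullet> n)" using nt by (simp add: w_def inner_diff_left)
  have wt: "w \<bullet> t = (Q - P) \<bullet> t" using nt by (simp add: w_def inner_diff_left)
  have w0: "w \<noteq> 0"
    using wn wt eq_zero_if_orthogonal_to_two[OF nt, of "Q - P"] assms(4) by auto
  have "reflection_in {q. (q - P) \<bullet> n = 0} (P + s *\<^sub>R (Q - P)) = P + s *\<^sub>R w" for s
    unfolding reflection_in_line[OF nt(1)] w_def by (simp add: algebra_simps)
  then have img: "reflection_in {q. (q - P) \<bullet> n = 0} ` (affine hull {P, Q})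
      = range (\<lambda>s. P + s *\<^sub>R w)"
    by (auto simp: affine_hull_2_alt image_image)
  have "range (\<lambda>s. P + s *\<^sub>R w) = range (\<lambda>s. P + s *\<^sub>R (R - P)) \<longleftrightarrow>
      (w \<bullet> n) * ((R - P) \<bullet> t) = (w \<bullet> t) * ((R - P) \<bullet> n)" (is "?L = ?R \<longleftrightarrow> ?E")
  proof
    assume eq: "?L = ?R"
    have "P + 1 *\<^sub>R w \<in> ?R" unfolding eq[symmetric] by (rule rangeI)
    then obtain s where "P + 1 *\<^sub>R w = P + s *\<^sub>R (R - P)" by (rule rangeE)
    then have "w = s *\<^sub>R (R - P)" by simp
    then show ?E by simp
  next
    assume ?E
    with nt assms(5) obtain k where k: "w = k *\<^sub>R (R - P)"
      using parallel_if_det_zero[of n t "R - P" w] by auto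
    with w0 have "k \<noteq> 0" by auto
    show "?L = ?R"
    proof (intro equalityI subsetI)
      fix x assume "x \<in> ?L"
      then obtain s where "x = P + s *\<^sub>R w" by blast
      then have "x = P + (s * k) *\<^sub>R (R - P)" by (simp add: k)
      then show "x \<in> ?R" by blast
    next
      fix x assume "x \<in> ?R"
      then obtain s where "x = P + s *\<^sub>R (R - P)" by blast
      then have "x = P + (s / k) *\<^sub>R w" using \<open>k \<noteq> 0\<close> by (simp add: k)
      then show "x \<in> ?L" by blast
    qed
  qed
  moreover have "(w \<bullet> n) * ((R - P) \<bullet> t) = (w \<bullet> t) * ((R - P) \<bullet> n) \<longleftrightarrow>
      ((Q - P) \<bullet> t) * ((R - P) \<bullet> n) + ((Q - P) \<bullet> n) * ((R - P) \<bullet> t) = 0"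
    unfolding wn wt by auto
  ultimately show ?thesis unfolding img affine_hull_2_alt[of P R] by (rule trans)
qed

section \<open>Algebra of the vertices of a billiard triangle\<close>

lemma quadratic_with_three_zeros:
  fixes p q r :: "'a::field"
  assumes "x \<noteq> y" "y \<noteq> z" "x \<noteq> z"
    and "p * x\<^sup>2 + q * x + r = 0" "p * y\<^sup>2 + q * y + r = 0" "p * z\<^sup>2 + q * z + r = 0"
  shows "p = 0" "q = 0" "r = 0"
proof -
  have slope: "p * (x + w) + q = 0" if "x \<noteq> w" "p * w\<^sup>2 + q * w + r = 0" for w
  proof -
    have "(x - w) * (p * (x + w) + q) = (p * x\<^sup>2 + q * x + r) - (p * w\<^sup>2 + q * w + r)"
      by (simp add: algebra_simps power2_eq_square)
    then show ?thesis using that assms(4) by simp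
  qed
  note * = slope[OF assms(1,5)] slope[OF assms(3,6)]
  have "p * (y - z) = (p * (x + y) + q) - (p * (x + z) + q)" by (simp add: algebra_simps)
  then have "p * (y - z) = 0" using * by simp
  then show "p = 0" using assms(2) by auto
  with * assms(4) show "q = 0" "r = 0" by auto
qed

text \<open>With \<open>m = 2 * (a * X - \<i> * b * Y)\<close> and \<open>n = cnj m\<close> the quartic is the equation for the points
  of the ellipse whose normal passes through \<open>(X, Y)\<close> (lemma \<open>complex_normal_line\<close>). Its remainder
  modulo the cubic with zeros \<open>z1\<close>, \<open>z2\<close>, \<open>z3\<close> has degree at most 2 and three zeros, hence is zero;
  its constant coefficient already determines \<open>m\<close> by the zeros.\<close>

lemma normals_concurrent:
  fixes D m n z1 z2 z3 :: "'a::field"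
  assumes distinct: "z1 \<noteq> z2" "z2 \<noteq> z3" "z1 \<noteq> z3"
    and normal: "\<And>z. z \<in> {z1, z2, z3} \<Longrightarrow> D * z^4 - m * z^3 + n * z - D = 0"
  shows "(z1 * z2 * z3) * m = D * ((z1 * z2 * z3) * (z1 + z2 + z3) - 1)"
proof -
  define s1 s2 s3 where s: "s1 = z1 + z2 + z3" "s2 = z1*z2 + z1*z3 + z2*z3" "s3 = z1*z2*z3"
  \<comment> \<open>the quotient of the quartic by the cubic is \<open>D * z + e\<close>\<close>
  define e where "e = D * s1 - m"
  have root: "z^3 - s1 * z\<^sup>2 + s2 * z - s3 = 0" if "z \<in> {z1, z2, z3}" for z
    using that by (auto simp: s algebra_simps power2_eq_square power3_eq_cube)
  have rem: "(s1 * e - D * s2) * z\<^sup>2 + (n - (s2 * e - D * s3)) * z + (s3 * e - D) = 0"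
    if "z \<in> {z1, z2, z3}" for z
  proof -
    have "(s1 * e - D * s2) * z\<^sup>2 + (n - (s2 * e - D * s3)) * z + (s3 * e - D)
        = (D * z^4 - m * z^3 + n * z - D) - (D * z + e) * (z^3 - s1 * z\<^sup>2 + s2 * z - s3)"
      by (simp add: e_def algebra_simps eval_nat_numeral)
    then show ?thesis by (simp add: root[OF that] normal[OF that])
  qed
  have "s3 * e - D = 0"
    by (rule quadratic_with_three_zeros(3)[OF distinct rem rem rem]) auto
  then show ?thesis by (simp add: e_def s algebra_simps)
qed

text \<open>The reflection law at the point \<open>z\<close> for the neighbours \<open>x\<close>, \<open>y\<close>, up to a nonzero factor; here
  \<open>D = a\<^sup>2 - b\<^sup>2\<close> and \<open>S = a\<^sup>2 + b\<^sup>2\<close>.\<close>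

definition reflection_poly :: "'a::field \<Rightarrow> 'a \<Rightarrow> 'a \<Rightarrow> 'a \<Rightarrow> 'a \<Rightarrow> 'a" where
  "reflection_poly D S z x y =
     2 * S * z * (z\<^sup>2 - x * y) - D * ((z^4 - 1) * (x + y) - 2 * z^3 * x * y + 2 * z)"

text \<open>When \<open>x\<close> and \<open>y\<close> are eliminated in favour of \<open>s1\<close> and \<open>s3\<close>, the three laws become one and the same
  polynomial of degree at most 5 in \<open>z\<close>, which has to vanish at all three vertices. That means divisibility
  by their cubic, and the three coefficients of the remainder are the conditions on the right.\<close>

lemma three_reflections_iff:
  fixes D S z1 z2 z3 :: "'a::field"
  defines "s1 \<equiv> z1 + z2 + z3" and "s2 \<equiv> z1*z2 + z1*z3 + z2*z3" and "s3 \<equiv> z1*z2*z3"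
  assumes distinct: "z1 \<noteq> z2" "z2 \<noteq> z3" "z1 \<noteq> z3"
  shows "reflection_poly D S z1 z2 z3 = 0 \<and> reflection_poly D S z2 z3 z1 = 0 \<and>
      reflection_poly D S z3 z1 z2 = 0 \<longleftrightarrow>
    s1 * (2 * S - D * s2) = - 3 * D * s3 \<and> s2 * (2 * S - D * s2) = - 3 * D \<and>
    D * s1 = D * s2 * s3"
    (is "?refl \<longleftrightarrow> ?sym")
proof -
  \<comment> \<open>the remainder on division by the cubic; at the vertices it agrees with the polynomial\<close>
  define rem where "rem z = (3 * D * s3 + s1 * (2 * S - D * s2)) * z\<^sup>2 +
    (- 3 * D - s2 * (2 * S - D * s2)) * z + (D * s1 - D * s2 * s3)" for z
  have rem: "reflection_poly D S z1 z2 z3 = rem z1" "reflection_poly D S z2 z3 z1 = rem z2"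
    "reflection_poly D S z3 z1 z2 = rem z3"
    unfolding reflection_poly_def rem_def s1_def s2_def s3_def
    by (simp_all add: algebra_simps eval_nat_numeral)
  show ?thesis
  proof
    assume ?refl
    then have *: "rem z1 = 0" "rem z2 = 0" "rem z3 = 0" by (simp_all add: rem)
    note z = quadratic_with_three_zeros[OF distinct *[unfolded rem_def]]
    have "s1 * (2 * S - D * s2) = - 3 * D * s3" using z(1) by (simp add: add_eq_0_iff)
    moreover have "s2 * (2 * S - D * s2) = - 3 * D" using z(2) by simp
    moreover have "D * s1 = D * s2 * s3" using z(3) by simp
    ultimately show ?sym by blast
  next
    assume ?sym
    then have "3 * D * s3 + s1 * (2 * S - D * s2) = 0" "- 3 * D - s2 * (2 * S - D * s2) = 0"
      "D * s1 - D * s2 * s3 = 0" by simp_all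
    then have "rem z = 0" for z unfolding rem_def by (simp only: mult_zero_left add_0)
    then show ?refl by (simp add: rem)
  qed
qed

lemma complex_cubic_splits:
  fixes p q r :: complex
  obtains z1 z2 z3 where
    "z1 + z2 + z3 = p" "z1 * z2 + z1 * z3 + z2 * z3 = q" "z1 * z2 * z3 = r"
proof -
  have "\<not> constant (poly [:- r, q, - p, 1:])" by (simp add: constant_degree)
  then obtain z1 where "poly [:- r, q, - p, 1:] z1 = 0"
    using fundamental_theorem_of_algebra by blast
  then have z1: "z1 * (q - z1 * (p - z1)) = r" by (simp add: algebra_simps)
  define w where "w = csqrt ((p - z1)\<^sup>2 - 4 * (q - z1 * (p - z1)))"
  have w: "w\<^sup>2 = (p - z1)\<^sup>2 - 4 * (q - z1 * (p - z1))" by (simp add: w_def)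
  define z2 z3 where z: "z2 = (p - z1 + w) / 2" "z3 = (p - z1 - w) / 2"
  have sum: "z2 + z3 = p - z1" by (simp add: z field_simps)
  have "4 * (z2 * z3) = (p - z1)\<^sup>2 - w\<^sup>2" by (simp add: z field_simps power2_eq_square)
  also have "\<dots> = 4 * (q - z1 * (p - z1))" using w by simp
  finally have prod: "z2 * z3 = q - z1 * (p - z1)" by (simp only: mult_cancel_left) simp
  show ?thesis
  proof (rule that)
    show "z1 + z2 + z3 = p" using sum by algebra
    show "z1 * z2 + z1 * z3 + z2 * z3 = q" using sum prod by algebra
    show "z1 * z2 * z3 = r" using z1 prod by (simp add: mult.assoc)
  qed
qed

text \<open>The equation reads \<open>B z = s\<close> for the Blaschke product \<open>B z = z * (z\<^sup>2 - \<mu>) / (1 - \<mu> * z\<^sup>2)\<close>, which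
  maps the open disc and its exterior (in the Riemann sphere) into themselves; so only points of the
  unit circle have an image of modulus 1.\<close>

lemma blaschke_root_on_circle:
  fixes \<mu> :: real and s z :: complex
  assumes \<mu>: "\<bar>\<mu>\<bar> < 1" and s: "cmod s = 1"
    and root: "z * (z\<^sup>2 - of_real \<mu>) = s * (1 - of_real \<mu> * z\<^sup>2)"
  shows "cmod z = 1"
proof -
  define w where "w = z\<^sup>2"
  have eq: "cmod z * cmod (w - of_real \<mu>) = cmod (1 - of_real \<mu> * w)"
    using arg_cong[OF root, of cmod] s by (simp add: norm_mult w_def)
  have diff: "(cmod (1 - of_real \<mu> * w))\<^sup>2 - (cmod (w - of_real \<mu>))\<^sup>2 = (1 - \<mu>\<^sup>2) * (1 - (cmod w)\<^sup>2)"
    unfolding cmod_power2 by (simp add: power2_eq_square algebra_simps)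
  have \<mu>2: "1 - \<mu>\<^sup>2 > 0" using \<mu> by (simp add: abs_square_less_1)
  have wz: "cmod w = (cmod z)\<^sup>2" by (simp add: w_def norm_power)
  show ?thesis
  proof (rule linorder_cases[of "cmod z" 1])
    assume lt: "cmod z < 1"
    then have "(cmod w)\<^sup>2 < 1" by (simp add: wz power_less_one_iff flip: power_mult)
    then have "(cmod (w - of_real \<mu>))\<^sup>2 < (cmod (1 - of_real \<mu> * w))\<^sup>2"
      using diff \<mu>2 by (smt (verit) mult_pos_pos)
    then have "cmod (w - of_real \<mu>) < cmod (1 - of_real \<mu> * w)"
      by (simp add: power_less_imp_less_base)
    moreover have "cmod z * cmod (w - of_real \<mu>) \<le> cmod (w - of_real \<mu>)"
      using lt by (simp add: mult_left_le_one_le)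
    ultimately show ?thesis using eq by simp
  next
    assume gt: "cmod z > 1"
    then have "(cmod w)\<^sup>2 > 1" by (simp add: wz flip: power_mult)
    then have "(cmod (1 - of_real \<mu> * w))\<^sup>2 < (cmod (w - of_real \<mu>))\<^sup>2"
      using diff \<mu>2 by (smt (verit) mult_pos_neg)
    then have "cmod (1 - of_real \<mu> * w) < cmod (w - of_real \<mu>)"
      by (simp add: power_less_imp_less_base)
    moreover have "cmod (w - of_real \<mu>) \<le> cmod z * cmod (w - of_real \<mu>)"
      using gt by (simp add: mult_le_cancel_right1)
    ultimately show ?thesis using eq by simp
  qed
qed

text \<open>The sums and products prescribed here are those of the vertices of a billiard triangle with
  \<open>z1 * z2 * z3 = s\<close>. A double zero \<open>x\<close> with third zero \<open>y\<close> is impossible, because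
  \<open>\<bar>x\<^sup>2 + 2 * x * y\<bar> \<ge> 2 - 1\<close> on the unit circle, while \<open>\<bar>\<mu>\<bar> < 1\<close>.\<close>

lemma unimodular_triple_exists:
  fixes \<mu> :: real and s :: complex
  assumes \<mu>: "\<bar>\<mu>\<bar> < 1" and s: "cmod s = 1"
  obtains z1 z2 z3 where "cmod z1 = 1" "cmod z2 = 1" "cmod z3 = 1"
    "z1 \<noteq> z2" "z2 \<noteq> z3" "z1 \<noteq> z3"
    "z1 + z2 + z3 = - of_real \<mu> * s" "z1 * z2 + z1 * z3 + z2 * z3 = - of_real \<mu>" "z1 * z2 * z3 = s"
proof -
  obtain z1 z2 z3 where sym: "z1 + z2 + z3 = - of_real \<mu> * s"
      "z1 * z2 + z1 * z3 + z2 * z3 = - of_real \<mu>" "z1 * z2 * z3 = s"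
    using complex_cubic_splits by blast
  have unit: "cmod z = 1" if "z \<in> {z1, z2, z3}" for z
  proof (rule blaschke_root_on_circle[OF \<mu> s])
    have "z^3 - (z1 + z2 + z3) * z\<^sup>2 + (z1 * z2 + z1 * z3 + z2 * z3) * z - z1 * z2 * z3 = 0"
      using that by (auto simp: algebra_simps power2_eq_square power3_eq_cube)
    then show "z * (z\<^sup>2 - of_real \<mu>) = s * (1 - of_real \<mu> * z\<^sup>2)"
      unfolding sym by (simp add: algebra_simps power2_eq_square power3_eq_cube)
  qed
  note unit = unit[of z1, simplified] unit[of z2, simplified] unit[of z3, simplified]
  have simple: "x\<^sup>2 + 2 * (x * y) \<noteq> - of_real \<mu>" if "cmod x = 1" "cmod y = 1" for x y
  proof
    assume "x\<^sup>2 + 2 * (x * y) = - of_real \<mu>"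
    then have "2 * (x * y) = - of_real \<mu> - x\<^sup>2" by (simp add: eq_diff_eq add.commute)
    then have "cmod (2 * (x * y)) \<le> cmod (- of_real \<mu>) + cmod (x\<^sup>2)"
      by (metis norm_triangle_ineq4)
    then show False using that \<mu> by (simp add: norm_mult norm_power)
  qed
  have "z1 \<noteq> z2" using simple[OF unit(1,3)] sym(2)
    by (auto simp: power2_eq_square algebra_simps)
  moreover have "z2 \<noteq> z3" using simple[OF unit(2,1)] sym(2)
    by (auto simp: power2_eq_square algebra_simps)
  moreover have "z1 \<noteq> z3" using simple[OF unit(1,2)] sym(2)
    by (auto simp: power2_eq_square algebra_simps)
  ultimately show ?thesis using that unit sym by blast
qed

text \<open>The root of \<open>D * x\<^sup>2 + 2 * S * x = 3 * D\<close> of absolute value less than 1. It is written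
  with the square root in the denominator because this form stays meaningful, with value 0, in the case \<open>D = 0\<close> of a circle.\<close>

definition orbit_const :: "real \<Rightarrow> real \<Rightarrow> real" where
  "orbit_const D S = 3 * D / (S + sqrt (S\<^sup>2 + 3 * D\<^sup>2))"

lemma orbit_const:
  assumes "\<bar>D\<bar> < S"
  shows orbit_const_root: "D * (orbit_const D S)\<^sup>2 + 2 * S * orbit_const D S = 3 * D"
    and orbit_const_less_1: "\<bar>orbit_const D S\<bar> < 1"
    and orbit_const_bound: "3 * \<bar>D\<bar> < D * orbit_const D S + 2 * S"
proof -
  define r where "r = sqrt (S\<^sup>2 + 3 * D\<^sup>2)"
  have r2: "r\<^sup>2 = S\<^sup>2 + 3 * D\<^sup>2" by (simp add: r_def)
  have "\<bar>D\<bar>\<^sup>2 < S\<^sup>2" using assms by (intro power_strict_mono) auto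
  then have "(2 * \<bar>D\<bar>)\<^sup>2 < S\<^sup>2 + 3 * D\<^sup>2" by (simp add: power_mult_distrib)
  then have r: "2 * \<bar>D\<bar> < r" unfolding r_def by (rule real_less_rsqrt)
  have pos: "S + r > 0" using assms r by linarith
  have \<mu>: "orbit_const D S * (S + r) = 3 * D" using pos by (simp add: orbit_const_def r_def)
  have "(S + r) * (D * orbit_const D S) = (S + r) * (r - S)"
    using \<mu> r2 by algebra
  then have D\<mu>: "D * orbit_const D S = r - S" using pos by simp
  show "D * (orbit_const D S)\<^sup>2 + 2 * S * orbit_const D S = 3 * D"
    using \<mu> D\<mu> by algebra
  show "\<bar>orbit_const D S\<bar> < 1"
    using pos r assms by (simp add: orbit_const_def r_def[symmetric] abs_mult)
  show "3 * \<bar>D\<bar> < D * orbit_const D S + 2 * S" using D\<mu> r assms by simp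
qed

text \<open>If \<open>D \<noteq> 0\<close>, the product of the two roots of the quadratic is \<open>- 3\<close>, so that the other root has modulus
  greater than 3. The bound 3 is what the sum of three unimodular numbers satisfies.\<close>

lemma orbit_const_unique:
  fixes D S :: real and w :: complex
  assumes DS: "\<bar>D\<bar> < S" and w: "cmod w \<le> 3"
    and root: "w * (2 * of_real S - of_real D * w) = - 3 * of_real D"
  shows "w = - of_real (orbit_const D S)"
proof -
  define \<mu> where "\<mu> = complex_of_real (orbit_const D S)"
  have \<mu>: "D * \<mu>\<^sup>2 + 2 * S * \<mu> = 3 * D"
    using arg_cong[OF orbit_const_root[OF DS], of complex_of_real] by (simp add: \<mu>_def)
  have "(w + \<mu>) * (D * w - (D * \<mu> + 2 * S))
      = - (w * (2 * S - D * w)) - (D * \<mu>\<^sup>2 + 2 * S * \<mu>)"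
    by (simp add: algebra_simps power2_eq_square)
  then have "(w + \<mu>) * (D * w - (D * \<mu> + 2 * S)) = 0" using root \<mu> by simp
  moreover have "D * w \<noteq> D * \<mu> + 2 * S"
  proof
    assume "D * w = D * \<mu> + 2 * S"
    also have "\<dots> = of_real (D * orbit_const D S + 2 * S)" by (simp add: \<mu>_def)
    finally have "cmod (D * w) = \<bar>D * orbit_const D S + 2 * S\<bar>" by (simp only: norm_of_real)
    then have "\<bar>D\<bar> * cmod w > 3 * \<bar>D\<bar>"
      using orbit_const_bound[OF DS] by (simp add: norm_mult)
    moreover have "\<bar>D\<bar> * cmod w \<le> \<bar>D\<bar> * 3" using w by (intro mult_left_mono) auto
    ultimately show False by simp
  qed
  ultimately show ?thesis by (simp add: \<mu>_def eq_neg_iff_add_eq_0)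
qed

section \<open>The ellipse as an image of the unit circle\<close>

definition ellipse_point :: "real^2 \<Rightarrow> real^2 \<Rightarrow> real^2 \<Rightarrow> real \<Rightarrow> real \<Rightarrow> complex \<Rightarrow> real^2" where
  "ellipse_point c u v a b z = c + (a * Re z) *\<^sub>R u + (b * Im z) *\<^sub>R v"

lemma unit_complex_iff: "cmod z = 1 \<longleftrightarrow> (Re z)\<^sup>2 + (Im z)\<^sup>2 = 1"
  by (simp add: cmod_def)

text \<open>The semi-axes are only required to be nonzero because in the locus of incenters they come out
  negative if \<open>a < b\<close>.\<close>

lemma ellipse_point_image:
  fixes c u v :: "real^2" and a b :: real
  assumes "norm u = 1" "norm v = 1" "u \<bullet> v = 0" and "a \<noteq> 0" "b \<noteq> 0"
  shows "ellipse_point c u v a b ` sphere 0 1 =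
    {p. ((p - c) \<bullet> u)\<^sup>2 / a\<^sup>2 + ((p - c) \<bullet> v)\<^sup>2 / b\<^sup>2 = 1}" (is "?L = ?R")
proof (intro equalityI subsetI)
  fix p assume "p \<in> ?L"
  then obtain z where z: "cmod z = 1" "p = ellipse_point c u v a b z" by auto
  have "u \<bullet> u = 1" "v \<bullet> v = 1" "v \<bullet> u = 0"
    using assms by (simp_all add: dot_square_norm inner_commute)
  then show "p \<in> ?R" using assms z
    by (simp add: ellipse_point_def inner_add_left power_mult_distrib unit_complex_iff)
next
  fix p assume p: "p \<in> ?R"
  define z where "z = Complex (((p - c) \<bullet> u) / a) (((p - c) \<bullet> v) / b)"
  have "cmod z = 1" using p by (simp add: z_def unit_complex_iff power_divide)
  moreover have "(a * Re z) *\<^sub>R u + (b * Im z) *\<^sub>R v = p - c"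
    using orthonormal_expansion[OF assms(1-3), of "p - c", symmetric] assms(4,5)
    by (simp add: z_def)
  then have "p = ellipse_point c u v a b z" by (simp add: ellipse_point_def add.assoc)
  ultimately show "p \<in> ?L" by auto
qed

locale ellipse_frame =
  fixes c u v :: "real^2" and a b :: real
  assumes u: "norm u = 1" and v: "norm v = 1" and uv: "u \<bullet> v = 0" and a: "0 < a" and b: "0 < b"
begin

abbreviation pt :: "complex \<Rightarrow> real^2" where
  "pt \<equiv> ellipse_point c u v a b"

definition normal_at :: "complex \<Rightarrow> real^2" where
  "normal_at z = (Re z / a) *\<^sub>R u + (Im z / b) *\<^sub>R v"

definition tangent_at :: "complex \<Rightarrow> real^2" where
  "tangent_at z = (- a * Im z) *\<^sub>R u + (b * Re z) *\<^sub>R v"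

definition curve :: "(real^2) set" where
  "curve = {p. ((p - c) \<bullet> u)\<^sup>2 / a\<^sup>2 + ((p - c) \<bullet> v)\<^sup>2 / b\<^sup>2 = 1}"

lemma frame_inner: "u \<bullet> u = 1" "v \<bullet> v = 1" "u \<bullet> v = 0" "v \<bullet> u = 0"
  using u v uv by (simp_all add: dot_square_norm inner_commute)

lemma curve_eq_sphere:
  assumes "a = b"
  shows "curve = sphere c a"
proof -
  have "q \<in> curve \<longleftrightarrow> q \<in> sphere c a" for q
  proof -
    have "(dist q c)\<^sup>2 = ((q - c) \<bullet> u)\<^sup>2 + ((q - c) \<bullet> v)\<^sup>2"
      unfolding dist_norm power2_norm_eq_inner
      by (rule orthonormal_inner_self[OF u v uv])
    then have "q \<in> curve \<longleftrightarrow> (dist q c)\<^sup>2 = a\<^sup>2"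
      unfolding curve_def using a by (auto simp: assms[symmetric] add_divide_distrib[symmetric])
    also have "\<dots> \<longleftrightarrow> q \<in> sphere c a"
      using a by (simp add: power2_eq_iff_nonneg dist_commute)
    finally show ?thesis .
  qed
  then show ?thesis by blast
qed

lemma curve_eq_image: "curve = pt ` sphere 0 1"
  unfolding curve_def using ellipse_point_image[OF u v uv] a b by simp

lemma pt_in_curve: "cmod z = 1 \<Longrightarrow> pt z \<in> curve"
  by (simp add: curve_eq_image)

lemma pt_eq_iff: "pt z = pt w \<longleftrightarrow> z = w"
proof
  assume "pt z = pt w"
  then have "(pt z - c) \<bullet> u = (pt w - c) \<bullet> u" "(pt z - c) \<bullet> v = (pt w - c) \<bullet> v" by simp_all
  then show "z = w"
    using a b by (simp add: ellipse_point_def inner_add_left frame_inner complex_eq_iff)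
qed simp

lemma normal_tangent_orthogonal: "normal_at z \<bullet> tangent_at z = 0"
  using a b by (simp add: normal_at_def tangent_at_def inner_add_left inner_add_right
      inner_diff_left inner_diff_right frame_inner)

lemma unit_Re_or_Im_nonzero: "cmod z = 1 \<Longrightarrow> Re z \<noteq> 0 \<or> Im z \<noteq> 0"
  by (auto simp: unit_complex_iff)

lemma normal_nonzero: "cmod z = 1 \<Longrightarrow> normal_at z \<noteq> 0"
proof
  assume "cmod z = 1" "normal_at z = 0"
  then have "normal_at z \<bullet> u = 0" "normal_at z \<bullet> v = 0" by simp_all
  with \<open>cmod z = 1\<close> show False using a b unit_Re_or_Im_nonzero
    by (simp add: normal_at_def inner_add_left frame_inner)
qed

lemma tangent_nonzero: "cmod z = 1 \<Longrightarrow> tangent_at z \<noteq> 0"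
proof
  assume "cmod z = 1" "tangent_at z = 0"
  then have "tangent_at z \<bullet> u = 0" "tangent_at z \<bullet> v = 0" by simp_all
  with \<open>cmod z = 1\<close> show False using a b unit_Re_or_Im_nonzero
    by (simp add: tangent_at_def inner_add_left inner_diff_left frame_inner)
qed

text \<open>Differentiating the equation of the ellipse along a path shows that velocities are orthogonal to
  the normal; conversely, running through the parametrization at speed \<open>k\<close> realizes the velocity
  \<open>k *\<^sub>R tangent_at z\<close>.\<close>

lemma tangent_line_curve:
  assumes z: "cmod z = 1"
  shows "tangent_line curve (pt z) = {q. (q - pt z) \<bullet> normal_at z = 0}"
proof (intro equalityI subsetI)
  fix q assume "q \<in> tangent_line curve (pt z)"
  then obtain w \<gamma> where q: "q = pt z + w" and \<gamma>: "range \<gamma> \<subseteq> curve" "\<gamma> 0 = pt z"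
      and d: "(\<gamma> has_vector_derivative w) (at 0)"
    unfolding tangent_line_def by blast
  have deriv: "((\<lambda>t. (\<gamma> t - c) \<bullet> x) has_real_derivative w \<bullet> x) (at 0)" for x
  proof -
    have "((\<lambda>t. \<gamma> t - c) has_vector_derivative w) (at 0)"
      using has_vector_derivative_diff[OF d has_vector_derivative_const[of c]] by simp
    from bounded_linear.has_vector_derivative[OF bounded_linear_inner_left this, of x]
    show ?thesis by (simp add: has_real_derivative_iff_has_vector_derivative)
  qed
  have "((\<lambda>t. ((\<gamma> t - c) \<bullet> x)\<^sup>2) has_real_derivative 2 * ((\<gamma> 0 - c) \<bullet> x) * (w \<bullet> x)) (at 0)" for x
    using DERIV_power[OF deriv[of x], of 2] by (simp add: mult_ac)
  note sq = this[THEN DERIV_cdivide]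
  have "((\<lambda>t. ((\<gamma> t - c) \<bullet> u)\<^sup>2 / a\<^sup>2 + ((\<gamma> t - c) \<bullet> v)\<^sup>2 / b\<^sup>2) has_real_derivative
      2 * (a * Re z) * (w \<bullet> u) / a\<^sup>2 + 2 * (b * Im z) * (w \<bullet> v) / b\<^sup>2) (at 0)"
    using DERIV_add[OF sq[of u "a\<^sup>2"] sq[of v "b\<^sup>2"]]
    by (simp add: \<gamma> ellipse_point_def inner_add_left frame_inner)
  moreover have "(\<lambda>t. ((\<gamma> t - c) \<bullet> u)\<^sup>2 / a\<^sup>2 + ((\<gamma> t - c) \<bullet> v)\<^sup>2 / b\<^sup>2) = (\<lambda>t. 1)"
    using \<gamma>(1) by (auto simp: curve_def)
  ultimately have "((\<lambda>t. 1) has_real_derivative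
      2 * (a * Re z) * (w \<bullet> u) / a\<^sup>2 + 2 * (b * Im z) * (w \<bullet> v) / b\<^sup>2) (at 0)"
    by (simp only:)
  from DERIV_unique[OF this DERIV_const]
  have "2 * (a * Re z) * (w \<bullet> u) / a\<^sup>2 + 2 * (b * Im z) * (w \<bullet> v) / b\<^sup>2 = 0" .
  then show "q \<in> {q. (q - pt z) \<bullet> normal_at z = 0}"
    using a b by (simp add: q normal_at_def inner_add_right power2_eq_square field_simps)
next
  fix q assume "q \<in> {q. (q - pt z) \<bullet> normal_at z = 0}"
  then have "((q - pt z) \<bullet> normal_at z) * (tangent_at z \<bullet> tangent_at z) =
      ((q - pt z) \<bullet> tangent_at z) * (tangent_at z \<bullet> normal_at z)"
    using normal_tangent_orthogonal by (simp add: inner_commute)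
  then obtain k where k: "q - pt z = k *\<^sub>R tangent_at z"
    by (rule parallel_if_det_zero[OF normal_nonzero[OF z] tangent_nonzero[OF z]
          normal_tangent_orthogonal tangent_nonzero[OF z]])
  define \<gamma> where "\<gamma> t = pt (z * cis (k * t))" for t
  have re: "((\<lambda>t. a * Re (z * cis (k * t))) has_real_derivative k * (- a * Im z)) (at 0)"
    by (auto intro!: derivative_eq_intros)
  have im: "((\<lambda>t. b * Im (z * cis (k * t))) has_real_derivative k * (b * Re z)) (at 0)"
    by (auto intro!: derivative_eq_intros)
  have "(\<gamma> has_vector_derivative 0 + (k * (- a * Im z)) *\<^sub>R u + (k * (b * Re z)) *\<^sub>R v) (at 0)"
    unfolding \<gamma>_def ellipse_point_def
    using has_vector_derivative_scaleR[OF re has_vector_derivative_const[of u]]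
      has_vector_derivative_scaleR[OF im has_vector_derivative_const[of v]]
    by (intro has_vector_derivative_add has_vector_derivative_const) simp_all
  then have "(\<gamma> has_vector_derivative k *\<^sub>R tangent_at z) (at 0)"
    by (simp add: tangent_at_def scaleR_add_right scaleR_diff_right)
  moreover have "range \<gamma> \<subseteq> curve" "\<gamma> 0 = pt z"
    using z by (auto simp: \<gamma>_def norm_mult intro!: pt_in_curve)
  ultimately have "pt z + k *\<^sub>R tangent_at z \<in> tangent_line curve (pt z)"
    unfolding tangent_line_def by blast
  then show "q \<in> tangent_line curve (pt z)" using k by (simp add: algebra_simps)
qed

text \<open>The parametrization is affine, so that this is strict convexity of the unit circle: a line through
  two of its points meets it for the parameters 0 and 1 only.\<close>

lemma not_collinear_pt:
  assumes unit: "cmod z1 = 1" "cmod z2 = 1" "cmod z3 = 1"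
    and distinct: "z1 \<noteq> z2" "z2 \<noteq> z3" "z1 \<noteq> z3"
  shows "\<not> collinear {pt z1, pt z2, pt z3}"
proof
  assume "collinear {pt z1, pt z2, pt z3}"
  then obtain k where k: "pt z2 = k *\<^sub>R pt z1 + (1 - k) *\<^sub>R pt z3"
    unfolding collinear_3_expand using distinct by (auto simp: pt_eq_iff)
  also have "\<dots> = pt (z3 + k *\<^sub>R (z1 - z3))"
    by (simp add: ellipse_point_def algebra_simps)
  finally have z2: "z2 = z3 + k *\<^sub>R (z1 - z3)" by (simp add: pt_eq_iff)
  have sq: "(cmod (z3 + t *\<^sub>R (z1 - z3)))\<^sup>2 = 1 + 2 * t * (z3 \<bullet> (z1 - z3)) + t\<^sup>2 * (cmod (z1 - z3))\<^sup>2"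
    for t
  proof -
    have "z3 \<bullet> z3 = 1" using unit(3) by (simp add: dot_square_norm)
    then show ?thesis unfolding power2_norm_eq_inner
      by (simp add: inner_add_left inner_add_right inner_commute power2_eq_square)
  qed
  have "2 * (z3 \<bullet> (z1 - z3)) + (cmod (z1 - z3))\<^sup>2 = 0" using sq[of 1] unit(1) by simp
  moreover have "2 * k * (z3 \<bullet> (z1 - z3)) + k\<^sup>2 * (cmod (z1 - z3))\<^sup>2 = 0"
    using sq[of k] unit(2) z2 by simp
  moreover have "k * (k - 1) * (cmod (z1 - z3))\<^sup>2 =
      (2 * k * (z3 \<bullet> (z1 - z3)) + k\<^sup>2 * (cmod (z1 - z3))\<^sup>2)
      - k * (2 * (z3 \<bullet> (z1 - z3)) + (cmod (z1 - z3))\<^sup>2)"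
    by (simp add: algebra_simps power2_eq_square)
  ultimately have "k * (k - 1) * (cmod (z1 - z3))\<^sup>2 = 0" by simp
  then have "k = 0 \<or> k = 1" using distinct(3) by simp
  then show False using z2 distinct by auto
qed

lemma chord_inner_normal:
  "cmod z = 1 \<Longrightarrow> (pt w - pt z) \<bullet> normal_at z = w \<bullet> z - 1"
  using a b by (simp add: ellipse_point_def normal_at_def inner_add_left inner_add_right inner_diff_left
      frame_inner inner_complex_def unit_complex_iff power2_eq_square algebra_simps)

lemma chord_inner_normal_neg:
  assumes "cmod z = 1" "cmod w = 1" "w \<noteq> z"
  shows "(pt w - pt z) \<bullet> normal_at z < 0"
proof -
  have "0 < (w - z) \<bullet> (w - z)" using assms(3) by simp
  also have "\<dots> = w \<bullet> w + z \<bullet> z - 2 * (w \<bullet> z)"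
    by (simp add: inner_diff_left inner_diff_right inner_commute)
  also have "\<dots> = 2 - 2 * (w \<bullet> z)" using assms by (simp add: dot_square_norm)
  finally show ?thesis using assms by (simp add: chord_inner_normal)
qed

lemma reflection_law_curve_iff:
  assumes "cmod z = 1" "Q \<noteq> pt z" "R \<noteq> pt z"
  shows "reflection_law curve (pt z) Q R \<longleftrightarrow>
    ((Q - pt z) \<bullet> tangent_at z) * ((R - pt z) \<bullet> normal_at z)
    + ((Q - pt z) \<bullet> normal_at z) * ((R - pt z) \<bullet> tangent_at z) = 0"
  unfolding reflection_law_def tangent_line_curve[OF assms(1)]
  by (rule reflection_exchanges_lines_iff)
    (use assms normal_nonzero tangent_nonzero normal_tangent_orthogonal in auto)

text \<open>On the unit circle \<open>cnj z = 1 / z\<close>. With these formulas every condition on the real coordinates of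
  points of the ellipse becomes a rational equation in complex numbers.\<close>

lemma unit_Re_Im:
  assumes "cmod z = 1"
  shows "z \<noteq> 0" "complex_of_real (Re z) = (z + 1 / z) / 2"
    "complex_of_real (Im z) = - \<i> * (z - 1 / z) / 2"
proof -
  show "z \<noteq> 0" using assms by auto
  have "z * cnj z = 1" using assms by (simp add: complex_norm_square[symmetric])
  then have c: "cnj z = 1 / z" using \<open>z \<noteq> 0\<close> by (simp add: field_simps)
  show "complex_of_real (Re z) = (z + 1 / z) / 2"
    using complex_add_cnj[of z] by (simp add: c)
  show "complex_of_real (Im z) = - \<i> * (z - 1 / z) / 2"
  proof -
    have "z - 1 / z = of_real (2 * Im z) * \<i>" using complex_diff_cnj[of z] by (simp add: c)
    then show ?thesis by (simp only:) (simp add: complex_eq_iff)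
  qed
qed

lemma complex_chord_inner_normal:
  assumes "cmod z = 1" "cmod w = 1"
  shows "of_real ((pt w - pt z) \<bullet> normal_at z) * (2 * z * w) = (w - z)\<^sup>2"
  unfolding chord_inner_normal[OF assms(1)] inner_complex_def of_real_diff of_real_add of_real_mult
    of_real_1 inner_real_def unit_Re_Im(2,3)[OF assms(1)] unit_Re_Im(2,3)[OF assms(2)]
  using unit_Re_Im(1)[OF assms(1)] unit_Re_Im(1)[OF assms(2)]
  by (simp add: field_simps power2_eq_square)

text \<open>The left-hand side vanishes if and only if the normal at \<open>z\<close> passes through the point with
  coordinates \<open>(X, Y)\<close>; so the feet of the normals through a point are zeros of a quartic.\<close>

lemma complex_normal_line:
  assumes "cmod z = 1"
  shows "of_real ((c + X *\<^sub>R u + Y *\<^sub>R v - pt z) \<bullet> tangent_at z) * (4 * \<i> * z\<^sup>2) =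
    of_real (a\<^sup>2 - b\<^sup>2) * z^4 - 2 * Complex (a * X) (- b * Y) * z^3
    + 2 * Complex (a * X) (b * Y) * z - of_real (a\<^sup>2 - b\<^sup>2)"
proof -
  have eq: "(c + X *\<^sub>R u + Y *\<^sub>R v - pt z) \<bullet> tangent_at z =
      - (a * X) * Im z + (b * Y) * Re z + (a\<^sup>2 - b\<^sup>2) * Re z * Im z"
    by (simp add: ellipse_point_def tangent_at_def inner_add_left inner_add_right inner_diff_left
      frame_inner algebra_simps power2_eq_square)
  have Complex: "Complex x y = of_real x + \<i> * of_real y" for x y
    by (simp add: complex_eq_iff)
  show ?thesis
    unfolding eq Complex of_real_diff of_real_add of_real_mult of_real_minus of_real_power
      unit_Re_Im(2,3)[OF assms]
    using unit_Re_Im(1)[OF assms] by (simp add: field_simps eval_nat_numeral)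
qed

lemma complex_chord_inner_tangent:
  assumes "cmod z = 1" "cmod w = 1"
  shows "of_real ((pt w - pt z) \<bullet> tangent_at z) * (4 * \<i> * z\<^sup>2 * w) =
    (w - z) * (of_real (a\<^sup>2 + b\<^sup>2) * z * (z + w) - of_real (a\<^sup>2 - b\<^sup>2) * (z^3 * w + 1))"
proof -
  have eq: "(pt w - pt z) \<bullet> tangent_at z =
      - a\<^sup>2 * Im z * (Re w - Re z) + b\<^sup>2 * Re z * (Im w - Im z)"
    by (simp add: ellipse_point_def tangent_at_def inner_add_left inner_add_right inner_diff_left
      frame_inner algebra_simps power2_eq_square)
  show ?thesis
    unfolding eq of_real_diff of_real_add of_real_mult of_real_minus of_real_power
      unit_Re_Im(2,3)[OF assms(1)] unit_Re_Im(2,3)[OF assms(2)]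
    using unit_Re_Im(1)[OF assms(1)] unit_Re_Im(1)[OF assms(2)]
    by (simp add: field_simps eval_nat_numeral)
qed

text \<open>Every chord from \<open>z\<close> to \<open>w\<close> contributes a factor \<open>w - z\<close>; since the vertices are distinct, these
  factors cancel, and what is left is the polynomial.\<close>

lemma reflection_law_iff_poly:
  assumes unit: "cmod z = 1" "cmod w = 1" "cmod y = 1" and "w \<noteq> z" "y \<noteq> z"
  shows "reflection_law curve (pt z) (pt w) (pt y) \<longleftrightarrow>
    reflection_poly (of_real (a\<^sup>2 - b\<^sup>2)) (of_real (a\<^sup>2 + b\<^sup>2)) z w y = 0"
proof -
  define D S where DS: "D = complex_of_real (a\<^sup>2 - b\<^sup>2)" "S = complex_of_real (a\<^sup>2 + b\<^sup>2)"
  define tw nw ty ny where tn: "tw = complex_of_real ((pt w - pt z) \<bullet> tangent_at z)"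
    "nw = complex_of_real ((pt w - pt z) \<bullet> normal_at z)"
    "ty = complex_of_real ((pt y - pt z) \<bullet> tangent_at z)"
    "ny = complex_of_real ((pt y - pt z) \<bullet> normal_at z)"
  define H where "H x = S * z * (z + x) - D * (z^3 * x + 1)" for x
  have nz: "z \<noteq> 0" "w \<noteq> 0" "y \<noteq> 0" using unit by auto
  have t: "tw * (4 * \<i> * z\<^sup>2 * w) = (w - z) * H w" "ty * (4 * \<i> * z\<^sup>2 * y) = (y - z) * H y"
    unfolding tn H_def DS using complex_chord_inner_tangent unit by blast+
  have n: "nw * (2 * z * w) = (w - z)\<^sup>2" "ny * (2 * z * y) = (y - z)\<^sup>2"
    unfolding tn using complex_chord_inner_normal unit by blast+
  have "(tw * ny + nw * ty) * (8 * \<i> * z^3 * w * y) =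
      (tw * (4 * \<i> * z\<^sup>2 * w)) * (ny * (2 * z * y)) + (nw * (2 * z * w)) * (ty * (4 * \<i> * z\<^sup>2 * y))"
    by (simp add: algebra_simps power2_eq_square power3_eq_cube)
  also have "\<dots> = (w - z) * (y - z) * (H w * (y - z) + H y * (w - z))"
    unfolding t n by (simp add: algebra_simps power2_eq_square)
  also have "H w * (y - z) + H y * (w - z) = - reflection_poly D S z w y"
    by (simp add: H_def reflection_poly_def algebra_simps eval_nat_numeral)
  finally have "tw * ny + nw * ty = 0 \<longleftrightarrow> reflection_poly D S z w y = 0"
    using nz assms(4,5) by auto
  moreover have "reflection_law curve (pt z) (pt w) (pt y) \<longleftrightarrow> tw * ny + nw * ty = 0"
    using assms unfolding tn of_real_mult[symmetric] of_real_add[symmetric] of_real_eq_0_iff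
    by (intro reflection_law_curve_iff) (auto simp: pt_eq_iff)
  ultimately show ?thesis by (simp add: DS)
qed

end

section \<open>Incenters of triangles\<close>

lemma tangent_line_sphere:
  fixes p T :: "real^2"
  assumes T: "dist p T = r" and r: "0 < r"
  shows "tangent_line (sphere p r) T = {q. (q - T) \<bullet> (T - p) = 0}"
proof -
  interpret ellipse_frame p "axis 1 1" "axis 2 1" r r
    by standard (use r in \<open>auto simp: inner_axis_axis norm_axis_1\<close>)
  note curve = curve_eq_sphere[OF refl]
  have "T \<in> curve" using T curve by simp
  then obtain z where z: "cmod z = 1" "T = pt z" by (auto simp: curve_eq_image)
  have "T - p = (r * r) *\<^sub>R normal_at z"
    using r by (simp add: z ellipse_point_def normal_at_def scaleR_add_right)
  then show ?thesis
    using tangent_line_curve[OF z(1)] r by (simp add: curve z(2))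
qed

lemma touches_side_sphere_iff:
  fixes p A B :: "real^2"
  assumes r: "0 < r" and AB: "A \<noteq> B"
  shows "touches_side (sphere p r) A B \<longleftrightarrow>
    (\<exists>T \<in> closed_segment A B. dist p T = r \<and> (T - p) \<bullet> (B - A) = 0)"
proof -
  have "tangent_line (sphere p r) T = affine hull {A, B} \<longleftrightarrow> (T - p) \<bullet> (B - A) = 0"
    if T: "T \<in> closed_segment A B" "dist p T = r" for T
  proof -
    have tl: "tangent_line (sphere p r) T = {q. (q - T) \<bullet> (T - p) = 0}"
      by (rule tangent_line_sphere[OF T(2) r])
    obtain k where k: "T = A + k *\<^sub>R (B - A)"
      using T(1) by (auto simp: in_segment algebra_simps)
    show ?thesis
    proof
      assume "tangent_line (sphere p r) T = affine hull {A, B}"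
      then have "A \<in> tangent_line (sphere p r) T" "B \<in> tangent_line (sphere p r) T"
        by (auto simp: hull_inc)
      then show "(T - p) \<bullet> (B - A) = 0"
        by (simp add: tl inner_diff_left inner_diff_right inner_commute)
    next
      assume orth: "(T - p) \<bullet> (B - A) = 0"
      have "T - p \<noteq> 0" using T(2) r by auto
      show "tangent_line (sphere p r) T = affine hull {A, B}"
        unfolding tl affine_hull_2_alt
      proof (intro equalityI subsetI)
        fix q assume "q \<in> {q. (q - T) \<bullet> (T - p) = 0}"
        then have "((q - T) \<bullet> (T - p)) * ((B - A) \<bullet> (B - A)) =
            ((q - T) \<bullet> (B - A)) * ((B - A) \<bullet> (T - p))"
          using orth by (simp add: inner_commute)
        then obtain m where "q - T = m *\<^sub>R (B - A)"
          using parallel_if_det_zero[of "T - p" "B - A" "B - A" "q - T"] orth AB \<open>T - p \<noteq> 0\<close>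
          by auto
        then have "q = T + m *\<^sub>R (B - A)" by (simp add: algebra_simps)
        then have "q = A + (k + m) *\<^sub>R (B - A)" by (simp add: k scaleR_add_left)
        then show "q \<in> range (\<lambda>t. A + t *\<^sub>R (B - A))" by blast
      next
        fix q assume "q \<in> range (\<lambda>t. A + t *\<^sub>R (B - A))"
        then obtain t where "q = A + t *\<^sub>R (B - A)" by blast
        then have "q - T = (t - k) *\<^sub>R (B - A)" by (simp add: k scaleR_diff_left)
        then show "q \<in> {q. (q - T) \<bullet> (T - p) = 0}" using orth by (simp add: inner_commute)
      qed
    qed
  qed
  then show ?thesis unfolding touches_side_def by auto
qed

lemma touches_side_commute: "touches_side K A B = touches_side K B A"
  by (simp add: touches_side_def closed_segment_commute insert_commute)

lemma incenter_rotate: "is_incenter p A B C \<Longrightarrow> is_incenter p B C A"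
  unfolding is_incenter_def by blast

text \<open>Pythagoras: the tangent segment from \<open>A\<close> to the circle has squared length \<open>(dist A p)\<^sup>2 - r\<^sup>2\<close>,
  whichever side it lies on; so the two tangent segments from a vertex have the same length.\<close>

lemma tangent_length:
  fixes p A B :: "real^2"
  assumes "0 < r" "A \<noteq> B" "touches_side (sphere p r) A B"
  shows "(p - A) \<bullet> sgn (B - A) \<ge> 0" "((p - A) \<bullet> sgn (B - A))\<^sup>2 = (p - A) \<bullet> (p - A) - r\<^sup>2"
proof -
  obtain T where T: "T \<in> closed_segment A B" "dist p T = r" "(T - p) \<bullet> (B - A) = 0"
    using assms touches_side_sphere_iff by blast
  obtain k where k: "T = A + k *\<^sub>R (B - A)" "0 \<le> k"
    using T(1) by (auto simp: in_segment algebra_simps)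
  define e where "e = sgn (B - A)"
  define l where "l = k * norm (B - A)"
  have BA: "B - A = norm (B - A) *\<^sub>R e" using assms(2) by (simp add: e_def sgn_div_norm)
  have ee: "e \<bullet> e = 1" using assms(2) by (simp add: e_def dot_square_norm norm_sgn)
  have orth: "(p - T) \<bullet> e = 0"
    using T(3) assms(2) by (simp add: e_def sgn_div_norm inner_diff_left)
  have "l *\<^sub>R e = k *\<^sub>R (norm (B - A) *\<^sub>R e)" by (simp add: l_def)
  then have "l *\<^sub>R e = k *\<^sub>R (B - A)" by (simp only: BA[symmetric])
  then have pA: "p - A = (p - T) + l *\<^sub>R e" using k by simp
  have l: "(p - A) \<bullet> e = l" unfolding pA inner_add_left using orth ee by simp
  have "(p - A) \<bullet> (p - A) = (p - T) \<bullet> (p - T) + l\<^sup>2"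
    unfolding pA inner_add_left inner_add_right using orth ee
    by (simp add: inner_commute power2_eq_square)
  moreover have "(p - T) \<bullet> (p - T) = r\<^sup>2" using T(2) by (simp add: dist_norm dot_square_norm)
  ultimately show "(p - A) \<bullet> sgn (B - A) \<ge> 0"
      "((p - A) \<bullet> sgn (B - A))\<^sup>2 = (p - A) \<bullet> (p - A) - r\<^sup>2"
    using l k(2) by (simp_all add: e_def[symmetric] l_def)
qed

lemma incenter_on_bisector:
  fixes p A B C :: "real^2"
  assumes "A \<noteq> B" "A \<noteq> C" "is_incenter p A B C"
  shows "(p - A) \<bullet> (sgn (B - A) - sgn (C - A)) = 0"
proof -
  obtain r where r: "0 < r" "touches_side (sphere p r) A B" "touches_side (sphere p r) A C"
    using assms(3) touches_side_commute unfolding is_incenter_def by blast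
  note B = tangent_length[OF r(1) assms(1) r(2)] and C = tangent_length[OF r(1) assms(2) r(3)]
  have "(p - A) \<bullet> sgn (B - A) = (p - A) \<bullet> sgn (C - A)"
    by (rule power2_eq_imp_eq) (use B C in simp_all)
  then show ?thesis by (simp add: inner_diff_right)
qed

text \<open>The unit directions \<open>sgn d\<close>, \<open>sgn e\<close> of the sides are exchanged, up to sign, by the reflection in
  the tangent \<open>t\<close>. As both point inwards, their normal components agree and their tangential
  components are opposite. So their difference is a nonzero multiple of \<open>t\<close>, and the internal bisector
  is the normal.\<close>

lemma bisector_orthogonal_tangent:
  fixes n t d e x :: "real^2"
  assumes nt: "n \<noteq> 0" "t \<noteq> 0" "n \<bullet> t = 0"
    and refl: "(d \<bullet> t) * (e \<bullet> n) + (d \<bullet> n) * (e \<bullet> t) = 0"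
    and inward: "d \<bullet> n < 0" "e \<bullet> n < 0"
    and distinct: "sgn d \<noteq> sgn e"
    and x: "x \<bullet> (sgn d - sgn e) = 0"
  shows "x \<bullet> t = 0"
proof -
  define N T where NT: "N = sgn n" "T = sgn t"
  have unit: "norm N = 1" "norm T = 1" "N \<bullet> T = 0"
    using nt by (simp_all add: NT norm_sgn sgn_div_norm)
  define p q p' q' where pq: "p = sgn d \<bullet> N" "q = sgn d \<bullet> T" "p' = sgn e \<bullet> N" "q' = sgn e \<bullet> T"
  have d: "d \<noteq> 0" "e \<noteq> 0" using inward by auto
  have expand: "sgn d = p *\<^sub>R N + q *\<^sub>R T" "sgn e = p' *\<^sub>R N + q' *\<^sub>R T"
    unfolding pq using orthonormal_expansion[OF unit] by blast+
  have ip: "N \<bullet> N = 1" "T \<bullet> T = 1" "T \<bullet> N = 0" "N \<bullet> T = 0"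
    using unit by (simp_all add: dot_square_norm inner_commute)
  have "sgn d \<bullet> sgn d = 1" "sgn e \<bullet> sgn e = 1" using d by (simp_all add: dot_square_norm norm_sgn)
  then have sq: "p\<^sup>2 + q\<^sup>2 = 1" "p'\<^sup>2 + q'\<^sup>2 = 1"
    unfolding expand by (simp_all add: inner_add_left inner_add_right ip power2_eq_square)
  have neg: "p < 0" "p' < 0"
    using inward d nt by (simp_all add: pq NT sgn_div_norm mult_less_0_iff)
  have "q * p' + p * q' = ((d \<bullet> t) * (e \<bullet> n) + (d \<bullet> n) * (e \<bullet> t)) /
      (norm d * norm e * norm n * norm t)"
    using d nt by (simp add: pq NT sgn_div_norm field_simps)
  then have cross: "q * p' = - (p * q')" using refl by simp
  have "(q * p')\<^sup>2 = (p * q')\<^sup>2" unfolding cross by (rule power2_minus)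
  moreover have q2: "q\<^sup>2 = 1 - p\<^sup>2" "q'\<^sup>2 = 1 - p'\<^sup>2" using sq by simp_all
  ultimately have "(1 - p\<^sup>2) * p'\<^sup>2 = p\<^sup>2 * (1 - p'\<^sup>2)"
    by (simp only: power_mult_distrib)
  then have "(- p)\<^sup>2 = (- p')\<^sup>2" by (simp add: algebra_simps)
  then have "- p = - p'" by (rule power2_eq_imp_eq) (use neg in simp_all)
  then have pp: "p' = p" by simp
  then have "p * (q' + q) = 0" using cross by (simp add: algebra_simps)
  then have qq: "q' = - q" using neg by (simp add: add_eq_0_iff2)
  have "q \<noteq> 0" using distinct pp qq unfolding expand by auto
  moreover have "sgn d - sgn e = (2 * q) *\<^sub>R T"
    unfolding expand pp qq mult_2 scaleR_add_left by simp
  ultimately have "x \<bullet> T = 0" using x by simp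
  then show ?thesis using nt by (simp add: NT sgn_div_norm)
qed

lemma sgn_sides_distinct:
  fixes A B C :: "real^2"
  assumes "\<not> collinear {A, B, C}"
  shows "sgn (B - A) \<noteq> sgn (C - A)"
proof
  assume eq: "sgn (B - A) = sgn (C - A)"
  have "A \<noteq> B" "A \<noteq> C" using assms by (auto simp: insert_commute)
  have "C - A = norm (C - A) *\<^sub>R sgn (C - A)" using \<open>A \<noteq> C\<close> by (simp add: sgn_div_norm)
  also have "\<dots> = (norm (C - A) / norm (B - A)) *\<^sub>R (B - A)"
    unfolding eq[symmetric] by (simp add: sgn_div_norm divide_inverse)
  finally have "collinear {0, B - A, C - A}" unfolding collinear_lemma by blast
  then have "collinear {B, A, C}" by (subst collinear_3) (simp_all add: NO_MATCH_def)
  then show False using assms by (simp add: insert_commute)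
qed

text \<open>The classical barycentric formula: the incenter has the side lengths as weights, the point of contact
  on \<open>AB\<close> is at distance \<open>s - \<alpha>\<close> from \<open>A\<close> for the semiperimeter \<open>s\<close>, and Heron gives the radius. One
  side suffices, because the formulas are invariant under cyclic permutation of the vertices.\<close>

lemma incenter_foot:
  fixes A B C :: "real^2"
  defines "\<alpha> \<equiv> dist B C" and "\<beta> \<equiv> dist C A" and "\<gamma> \<equiv> dist A B"
  defines "s \<equiv> (\<alpha> + \<beta> + \<gamma>) / 2"
  defines "p \<equiv> (1 / (2 * s)) *\<^sub>R (\<alpha> *\<^sub>R A + \<beta> *\<^sub>R B + \<gamma> *\<^sub>R C)"
  assumes nc: "\<not> collinear {A, B, C}"
    and r: "0 < r" "r\<^sup>2 * s = (s - \<alpha>) * (s - \<beta>) * (s - \<gamma>)"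
  shows "touches_side (sphere p r) A B"
proof -
  have AB: "A \<noteq> B" using nc by auto
  have \<gamma>0: "\<gamma> > 0" using AB by (simp add: \<gamma>_def)
  have s0: "s > 0" using \<gamma>0 by (simp add: s_def \<alpha>_def \<beta>_def add_nonneg_pos)
  define b c where bc: "b = B - A" "c = C - A"
  have bb: "b \<bullet> b = \<gamma>\<^sup>2" by (simp add: bc \<gamma>_def dist_norm dot_square_norm norm_minus_commute)
  have cc: "c \<bullet> c = \<beta>\<^sup>2" by (simp add: bc \<beta>_def dist_norm dot_square_norm)
  have "(b - c) \<bullet> (b - c) = \<alpha>\<^sup>2" by (simp add: bc \<alpha>_def dist_norm dot_square_norm)
  then have bc2: "2 * (b \<bullet> c) = \<beta>\<^sup>2 + \<gamma>\<^sup>2 - \<alpha>\<^sup>2"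
    using bb cc by (simp add: inner_diff_left inner_diff_right inner_commute)
  have \<alpha>: "\<alpha> = 2 * s - \<beta> - \<gamma>" by (simp add: s_def field_simps)
  define k where "k = (s - \<alpha>) / \<gamma>"
  define T where "T = A + k *\<^sub>R b"
  have "(2 * s) *\<^sub>R p = \<alpha> *\<^sub>R A + \<beta> *\<^sub>R B + \<gamma> *\<^sub>R C" using s0 by (simp add: p_def)
  also have "\<dots> = (2 * s) *\<^sub>R A + \<beta> *\<^sub>R b + \<gamma> *\<^sub>R c"
    unfolding \<alpha> bc by (simp add: algebra_simps)
  finally have "(2 * s) *\<^sub>R (p - A) = \<beta> *\<^sub>R b + \<gamma> *\<^sub>R c" by (simp add: algebra_simps)
  from arg_cong[OF this, of "\<lambda>y. y \<bullet> x" for x]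
  have pA: "2 * s * ((p - A) \<bullet> x) = \<beta> * (b \<bullet> x) + \<gamma> * (c \<bullet> x)" for x
    by (simp add: inner_add_left)
  have pAb: "(p - A) \<bullet> b = \<gamma> * (s - \<alpha>)"
  proof -
    have "4 * s * ((p - A) \<bullet> b) = 2 * \<beta> * (b \<bullet> b) + \<gamma> * (2 * (b \<bullet> c))"
      using pA[of b] by (simp add: inner_commute)
    also have "\<dots> = 4 * s * (\<gamma> * (s - \<alpha>))"
      unfolding bc2 bb \<alpha> by (simp add: algebra_simps power2_eq_square)
    finally show ?thesis using s0 by simp
  qed
  have pAc: "(p - A) \<bullet> c = \<beta> * (s - \<alpha>)"
  proof -
    have "4 * s * ((p - A) \<bullet> c) = 2 * \<gamma> * (c \<bullet> c) + \<beta> * (2 * (b \<bullet> c))"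
      using pA[of c] by simp
    also have "\<dots> = 4 * s * (\<beta> * (s - \<alpha>))"
      unfolding bc2 cc \<alpha> by (simp add: algebra_simps power2_eq_square)
    finally show ?thesis using s0 by simp
  qed
  have "2 * s * ((p - A) \<bullet> (p - A)) = \<beta> * ((p - A) \<bullet> b) + \<gamma> * ((p - A) \<bullet> c)"
    using pA[of "p - A"] by (simp add: inner_commute)
  then have pAp: "s * ((p - A) \<bullet> (p - A)) = \<beta> * \<gamma> * (s - \<alpha>)"
    unfolding pAb pAc by simp
  have kg: "k * \<gamma> = s - \<alpha>" using \<gamma>0 by (simp add: k_def)
  have orth: "(T - p) \<bullet> b = 0"
  proof -
    have "(T - p) \<bullet> b = k * (b \<bullet> b) - (p - A) \<bullet> b"
      by (simp add: T_def inner_add_left inner_diff_left)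
    also have "k * (b \<bullet> b) = (k * \<gamma>) * \<gamma>" by (simp add: bb power2_eq_square)
    finally show ?thesis by (simp add: kg pAb)
  qed
  have Tp: "T - p = k *\<^sub>R b - (p - A)" by (simp add: T_def)
  then have "(T - p) \<bullet> (T - p) = (T - p) \<bullet> (k *\<^sub>R b - (p - A))" by (simp only:)
  also have "\<dots> = - ((T - p) \<bullet> (p - A))" using orth by (simp add: inner_diff_right)
  also have "\<dots> = (p - A) \<bullet> (p - A) - k * ((p - A) \<bullet> b)"
    by (simp add: T_def inner_add_left inner_add_right inner_diff_left inner_diff_right
        inner_commute algebra_simps)
  also have "k * ((p - A) \<bullet> b) = (s - \<alpha>)\<^sup>2"
    unfolding pAb using kg by (simp add: power2_eq_square flip: mult.assoc)
  finally have "s * ((T - p) \<bullet> (T - p)) = s * ((p - A) \<bullet> (p - A)) - s * (s - \<alpha>)\<^sup>2"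
    by (simp add: right_diff_distrib)
  also have "\<dots> = (s - \<alpha>) * (s - \<beta>) * (s - \<gamma>)"
    unfolding pAp \<alpha> by (simp add: algebra_simps power2_eq_square power3_eq_cube)
  finally have "s * ((T - p) \<bullet> (T - p)) = s * r\<^sup>2" using r(2) by (simp add: mult.commute)
  then have "(norm (T - p))\<^sup>2 = r\<^sup>2" using s0 by (simp add: power2_norm_eq_inner)
  then have dist: "dist p T = r" using r(1) by (simp add: dist_norm norm_minus_commute power2_eq_iff_nonneg)
  have "\<alpha> \<le> \<beta> + \<gamma>" "\<beta> \<le> \<alpha> + \<gamma>"
    unfolding \<alpha>_def \<beta>_def \<gamma>_def by (metis add.commute dist_commute dist_triangle)+
  then have "0 \<le> k" "k \<le> 1" using \<gamma>0 by (simp_all add: k_def s_def field_simps)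
  then have "T \<in> closed_segment A B"
    by (auto simp: T_def bc in_segment algebra_simps intro!: exI[of _ k])
  then show ?thesis
    unfolding touches_side_sphere_iff[OF r(1) AB] using orth dist by (auto simp: bc)
qed

lemma strict_triangle:
  fixes A B C :: "real^2"
  assumes "\<not> collinear {A, B, C}"
  shows "dist A B < dist B C + dist C A"
proof (rule ccontr)
  assume "\<not> ?thesis"
  then have "dist A B = dist A C + dist C B"
    using dist_triangle[of A B C] by (simp add: dist_commute)
  then have "between (A, B) C" by (simp add: between)
  then have "collinear {A, C, B}" by (rule between_imp_collinear)
  then show False using assms by (simp add: insert_commute)
qed

lemma incenter_exists:
  fixes A B C :: "real^2"
  assumes nc: "\<not> collinear {A, B, C}"
  obtains p where "is_incenter p A B C"
proof -
  define \<alpha> \<beta> \<gamma> where g: "\<alpha> = dist B C" "\<beta> = dist C A" "\<gamma> = dist A B"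
  define s where "s = (\<alpha> + \<beta> + \<gamma>) / 2"
  define p where "p = (1 / (2 * s)) *\<^sub>R (\<alpha> *\<^sub>R A + \<beta> *\<^sub>R B + \<gamma> *\<^sub>R C)"
  define r where "r = sqrt ((s - \<alpha>) * (s - \<beta>) * (s - \<gamma>) / s)"
  have nc': "\<not> collinear {B, C, A}" "\<not> collinear {C, A, B}"
    using nc by (simp_all add: insert_commute)
  have pos: "s - \<alpha> > 0" "s - \<beta> > 0" "s - \<gamma> > 0"
    using strict_triangle[OF nc] strict_triangle[OF nc'(1)] strict_triangle[OF nc'(2)]
    by (simp_all add: g s_def)
  then have s: "s > 0" by (simp add: g s_def add_nonneg_nonneg)
  have r: "0 < r" "r\<^sup>2 * s = (s - \<alpha>) * (s - \<beta>) * (s - \<gamma>)"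
    using pos s by (simp_all add: r_def)
  have "touches_side (sphere p r) A B"
    using incenter_foot[OF nc r(1)] r(2) unfolding p_def s_def g by blast
  moreover have "touches_side (sphere p r) B C"
    using incenter_foot[OF nc'(1) r(1)] r(2) unfolding p_def s_def g by (simp add: ac_simps)
  moreover have "touches_side (sphere p r) C A"
    using incenter_foot[OF nc'(2) r(1)] r(2) unfolding p_def s_def g by (simp add: ac_simps)
  ultimately show ?thesis using that r(1) unfolding is_incenter_def by blast
qed

section \<open>The locus of incenters\<close>

context ellipse_frame
begin

lemma incenter_on_normals:
  assumes unit: "cmod z = 1" "cmod w = 1" "cmod y = 1"
    and distinct: "z \<noteq> w" "w \<noteq> y" "z \<noteq> y"
    and refl: "reflection_law curve (pt z) (pt w) (pt y)"
    and p: "is_incenter p (pt z) (pt w) (pt y)"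
  shows "(p - pt z) \<bullet> tangent_at z = 0"
proof (rule bisector_orthogonal_tangent[OF normal_nonzero tangent_nonzero normal_tangent_orthogonal])
  have ne: "pt w \<noteq> pt z" "pt y \<noteq> pt z" using distinct by (auto simp: pt_eq_iff)
  show "((pt w - pt z) \<bullet> tangent_at z) * ((pt y - pt z) \<bullet> normal_at z)
      + ((pt w - pt z) \<bullet> normal_at z) * ((pt y - pt z) \<bullet> tangent_at z) = 0"
    using refl reflection_law_curve_iff[OF unit(1) ne] by blast
  show "(pt w - pt z) \<bullet> normal_at z < 0" "(pt y - pt z) \<bullet> normal_at z < 0"
    using chord_inner_normal_neg unit distinct by auto
  show "sgn (pt w - pt z) \<noteq> sgn (pt y - pt z)"
    by (rule sgn_sides_distinct[OF not_collinear_pt[OF unit distinct]])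
  show "(p - pt z) \<bullet> (sgn (pt w - pt z) - sgn (pt y - pt z)) = 0"
    by (rule incenter_on_bisector) (use ne p in auto)
qed (use unit in auto)

text \<open>By \<open>orbit_const_unique\<close>, \<open>- \<mu>\<close> is the value of \<open>z1 * z2 + z1 * z3 + z2 * z3\<close> shared by all billiard
  triangles in the ellipse.\<close>

definition \<mu> :: real where
  "\<mu> = orbit_const (a\<^sup>2 - b\<^sup>2) (a\<^sup>2 + b\<^sup>2)"

lemma abs_focal_less: "\<bar>a\<^sup>2 - b\<^sup>2\<bar> < a\<^sup>2 + b\<^sup>2"
  using a b by (simp add: abs_less_iff add_pos_pos)

lemma abs_\<mu>_less_1: "\<bar>\<mu>\<bar> < 1"
  unfolding \<mu>_def by (rule orbit_const_less_1[OF abs_focal_less])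

text \<open>The parametrization of the locus; \<open>incenter_point s\<close> is the incenter of the billiard triangle
  with \<open>z1 * z2 * z3 = - s\<close>.\<close>

definition incenter_point :: "complex \<Rightarrow> real^2" where
  "incenter_point =
    ellipse_point c u v ((a\<^sup>2 - b\<^sup>2) * (1 + \<mu>) / (2 * a)) ((a\<^sup>2 - b\<^sup>2) * (1 - \<mu>) / (2 * b))"

lemma triangular_orbit_iff:
  assumes unit: "cmod z1 = 1" "cmod z2 = 1" "cmod z3 = 1"
    and distinct: "z1 \<noteq> z2" "z2 \<noteq> z3" "z1 \<noteq> z3"
  defines "D \<equiv> complex_of_real (a\<^sup>2 - b\<^sup>2)" and "S \<equiv> complex_of_real (a\<^sup>2 + b\<^sup>2)"
    and "s1 \<equiv> z1 + z2 + z3" and "s2 \<equiv> z1*z2 + z1*z3 + z2*z3" and "s3 \<equiv> z1*z2*z3"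
  shows "triangular_orbit curve (pt z1) (pt z2) (pt z3) \<longleftrightarrow>
    s1 * (2 * S - D * s2) = - 3 * D * s3 \<and> s2 * (2 * S - D * s2) = - 3 * D \<and>
    D * s1 = D * s2 * s3"
proof -
  have "triangular_orbit curve (pt z1) (pt z2) (pt z3) \<longleftrightarrow>
      reflection_poly D S z1 z2 z3 = 0 \<and> reflection_poly D S z2 z3 z1 = 0 \<and>
      reflection_poly D S z3 z1 z2 = 0"
    unfolding triangular_orbit_def D_def S_def
    using not_collinear_pt[OF unit distinct] pt_in_curve unit distinct
      reflection_law_iff_poly[of z1 z2 z3] reflection_law_iff_poly[of z2 z3 z1]
      reflection_law_iff_poly[of z3 z1 z2]
    by auto
  then show ?thesis
    using three_reflections_iff[OF distinct, of D S] unfolding s1_def s2_def s3_def by simp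
qed

text \<open>The orbit conditions give \<open>s2 = - \<mu>\<close>, and concurrency of the normals at the vertices gives
  \<open>s3 * m = D * (s1 * s3 - 1)\<close> for \<open>m = 2 * (a * X - \<i> * b * Y)\<close>. Because of \<open>D * s1 = D * s2 * s3\<close>
  this is \<open>m = - D * (\<mu> * s3 + cnj s3)\<close>, whose real and imaginary parts are the coordinates.\<close>

lemma orbit_incenter_eq:
  assumes unit: "cmod z1 = 1" "cmod z2 = 1" "cmod z3 = 1"
    and orbit: "triangular_orbit curve (pt z1) (pt z2) (pt z3)"
    and p: "is_incenter p (pt z1) (pt z2) (pt z3)"
  shows "p = incenter_point (- (z1 * z2 * z3))"
proof -
  have distinct: "z1 \<noteq> z2" "z2 \<noteq> z3" "z1 \<noteq> z3"
    using orbit unfolding triangular_orbit_def by (auto simp: insert_commute)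
  define D S where DS: "D = complex_of_real (a\<^sup>2 - b\<^sup>2)" "S = complex_of_real (a\<^sup>2 + b\<^sup>2)"
  define s1 s2 s3 where s: "s1 = z1 + z2 + z3" "s2 = z1*z2 + z1*z3 + z2*z3" "s3 = z1*z2*z3"
  have sym: "s2 * (2 * S - D * s2) = - 3 * D" "D * s1 = D * s2 * s3"
    using triangular_orbit_iff[OF unit distinct] orbit unfolding s DS by auto
  have "cmod s2 \<le> cmod (z1*z2) + cmod (z1*z3) + cmod (z2*z3)"
    unfolding s by (meson add_mono norm_triangle_ineq order_refl order_trans)
  then have "cmod s2 \<le> 3" using unit by (simp add: norm_mult)
  then have s2: "s2 = - of_real \<mu>"
    using orbit_const_unique[OF abs_focal_less] sym(1) unfolding \<mu>_def DS by blast
  have "cmod s3 = 1" using unit by (simp add: s norm_mult)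
  then have s3: "s3 * cnj s3 = 1" "cmod s3 = 1" by (simp_all flip: complex_norm_square)
  define X Y where XY: "X = (p - c) \<bullet> u" "Y = (p - c) \<bullet> v"
  have p_eq: "p = c + X *\<^sub>R u + Y *\<^sub>R v"
    using orthonormal_expansion[OF u v uv, of "p - c", folded XY] by (simp add: algebra_simps)
  define m n where mn: "m = 2 * Complex (a * X) (- b * Y)" "n = 2 * Complex (a * X) (b * Y)"
  have foot: "(p - pt z) \<bullet> tangent_at z = 0" if "z \<in> {z1, z2, z3}" for z
    using that orbit p incenter_rotate[OF p] incenter_rotate[OF incenter_rotate[OF p]]
      incenter_on_normals[of z1 z2 z3 p] incenter_on_normals[of z2 z3 z1 p]
      incenter_on_normals[of z3 z1 z2 p] unit distinct
    unfolding triangular_orbit_def by auto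
  have normal: "D * z^4 - m * z^3 + n * z - D = 0" if z: "z \<in> {z1, z2, z3}" for z
  proof -
    have "cmod z = 1" using z unit by auto
    from complex_normal_line[OF this, of X Y] foot[OF z] show ?thesis
      unfolding p_eq[symmetric] DS mn by simp
  qed
  have "s3 * m = D * (s3 * s1 - 1)"
    unfolding s by (rule normals_concurrent[OF distinct normal])
  also have "\<dots> = s3 * (D * s1) - D * (s3 * cnj s3)" by (simp add: s3 algebra_simps)
  also have "\<dots> = s3 * (- D * (of_real \<mu> * s3 + cnj s3))"
    unfolding sym(2) s2 by (simp add: algebra_simps)
  finally have m: "m = - D * (of_real \<mu> * s3 + cnj s3)"
    using s3(2) by (metis mult_cancel_left norm_zero zero_neq_one)
  have "2 * (a * X) = - ((a\<^sup>2 - b\<^sup>2) * (\<mu> * Re s3 + Re s3))"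
    using arg_cong[OF m, of Re] by (simp add: mn DS algebra_simps)
  then have X: "X = (a\<^sup>2 - b\<^sup>2) * (1 + \<mu>) / (2 * a) * Re (- s3)"
    using a by (simp add: field_simps)
  have "2 * (b * Y) = (a\<^sup>2 - b\<^sup>2) * (\<mu> * Im s3 - Im s3)"
    using arg_cong[OF m, of Im] by (simp add: mn DS algebra_simps)
  then have Y: "Y = (a\<^sup>2 - b\<^sup>2) * (1 - \<mu>) / (2 * b) * Im (- s3)"
    using b by (simp add: field_simps)
  show ?thesis
    unfolding s[symmetric] incenter_point_def ellipse_point_def using p_eq X Y by simp
qed

text \<open>Conversely, every unimodular product of the vertices occurs. The incenter of the triangle so found
  need not be computed: it exists, and by the previous lemma there is only one candidate.\<close>

lemma incenters_curve: "incenters curve = incenter_point ` sphere 0 1"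
proof (intro equalityI subsetI)
  fix p assume "p \<in> incenters curve"
  then obtain A B C where orbit: "triangular_orbit curve A B C" and p: "is_incenter p A B C"
    unfolding incenters_def by blast
  then have "A \<in> curve" "B \<in> curve" "C \<in> curve" unfolding triangular_orbit_def by auto
  then obtain z1 z2 z3 where z: "cmod z1 = 1" "cmod z2 = 1" "cmod z3 = 1"
      "A = pt z1" "B = pt z2" "C = pt z3"
    unfolding curve_eq_image by auto
  then have "p = incenter_point (- (z1 * z2 * z3))"
    using orbit_incenter_eq orbit p by blast
  then show "p \<in> incenter_point ` sphere 0 1" using z by (auto simp: norm_mult)
next
  fix p assume "p \<in> incenter_point ` sphere 0 1"
  then obtain s where s: "cmod s = 1" "p = incenter_point s" by auto
  then obtain z1 z2 z3 where unit: "cmod z1 = 1" "cmod z2 = 1" "cmod z3 = 1"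
      and distinct: "z1 \<noteq> z2" "z2 \<noteq> z3" "z1 \<noteq> z3"
      and sym: "z1 + z2 + z3 = - of_real \<mu> * (- s)"
        "z1 * z2 + z1 * z3 + z2 * z3 = - of_real \<mu>" "z1 * z2 * z3 = - s"
    using unimodular_triple_exists[OF abs_\<mu>_less_1, of "- s"] by auto
  define m D R where mDR: "m = complex_of_real \<mu>" "D = complex_of_real (a\<^sup>2 - b\<^sup>2)"
    "R = 2 * complex_of_real (a\<^sup>2 + b\<^sup>2) - D * - m"
  have "(a\<^sup>2 - b\<^sup>2) * \<mu>\<^sup>2 + 2 * (a\<^sup>2 + b\<^sup>2) * \<mu> = 3 * (a\<^sup>2 - b\<^sup>2)"
    unfolding \<mu>_def by (rule orbit_const_root[OF abs_focal_less])
  from arg_cong[OF this, of complex_of_real] have mR: "m * R = 3 * D"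
    by (simp add: mDR algebra_simps power2_eq_square)
  have "- m * - s * R = s * (m * R)" by simp
  then have "- m * - s * R = - 3 * D * - s" "- m * R = - 3 * D" "D * (- m * - s) = D * - m * - s"
    unfolding mR using mR by simp_all
  then have orbit: "triangular_orbit curve (pt z1) (pt z2) (pt z3)"
    unfolding triangular_orbit_iff[OF unit distinct] sym mDR by blast
  obtain q where q: "is_incenter q (pt z1) (pt z2) (pt z3)"
    using incenter_exists not_collinear_pt[OF unit distinct] by blast
  have "q = p" using orbit_incenter_eq[OF unit orbit q] s sym(3) by simp
  then show "p \<in> incenters curve" using orbit q unfolding incenters_def by blast
qed

text \<open>A circle containing both ends of an axis of the ellipse has its centre on the other axis. Hence the
  two centres agree, and both semi-axes are equal to the radius.\<close>

lemma is_circle_curve_iff: "is_circle curve \<longleftrightarrow> a = b"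
proof
  assume "is_circle curve"
  then obtain d r where r: "0 < r" "curve = sphere d r" unfolding is_circle_def by blast
  define x where "x = c - d"
  have expand: "(x + p *\<^sub>R u + q *\<^sub>R v) \<bullet> (x + p *\<^sub>R u + q *\<^sub>R v) =
      x \<bullet> x + 2 * p * (x \<bullet> u) + 2 * q * (x \<bullet> v) + p\<^sup>2 + q\<^sup>2" for p q
    by (simp add: inner_add_left inner_add_right frame_inner inner_commute[of u x]
        inner_commute[of v x] power2_eq_square algebra_simps)
  \<comment> \<open>evaluated at the four vertices of the ellipse, where the linear terms cancel in pairs\<close>
  have "x \<bullet> x + 2 * (a * Re z) * (x \<bullet> u) + 2 * (b * Im z) * (x \<bullet> v)
      + (a * Re z)\<^sup>2 + (b * Im z)\<^sup>2 = r\<^sup>2" if "cmod z = 1" for z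
  proof -
    have "pt z - d = x + (a * Re z) *\<^sub>R u + (b * Im z) *\<^sub>R v"
      by (simp add: ellipse_point_def x_def)
    moreover have "(pt z - d) \<bullet> (pt z - d) = r\<^sup>2"
      using pt_in_curve[OF that] r by (simp add: dist_norm dot_square_norm norm_minus_commute)
    ultimately show ?thesis by (simp only: expand)
  qed
  from this[of 1] this[of "- 1"] this[of \<i>] this[of "- \<i>"]
  have "x \<bullet> x + a\<^sup>2 = r\<^sup>2" "x \<bullet> x + b\<^sup>2 = r\<^sup>2" by simp_all
  then have "a\<^sup>2 = b\<^sup>2" by linarith
  then show "a = b" using a b by (simp add: power2_eq_iff_nonneg)
next
  assume "a = b"
  then show "is_circle curve" using curve_eq_sphere a unfolding is_circle_def by blast
qed

end

theorem theorem1p1: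
  fixes \<Gamma> :: "(real^2) set"
  assumes "is_ellipse \<Gamma>"
  shows "if is_circle \<Gamma> then \<exists>p. incenters \<Gamma> = {p} else is_ellipse (incenters \<Gamma>)"
proof -
  obtain c u v a b where frame: "norm u = 1" "norm v = 1" "u \<bullet> v = 0" "0 < a" "0 < b"
      and \<Gamma>: "\<Gamma> = {p. ((p - c) \<bullet> u)\<^sup>2 / a\<^sup>2 + ((p - c) \<bullet> v)\<^sup>2 / b\<^sup>2 = 1}"
    using assms unfolding is_ellipse_def by blast
  interpret ellipse_frame c u v a b by standard (use frame in auto)
  have \<Gamma>: "\<Gamma> = curve" unfolding \<Gamma> curve_def ..
  show ?thesis
  proof (cases "a = b")
    case True
    have "incenter_point z = c" for z
      unfolding incenter_point_def ellipse_point_def by (simp add: True)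
    then have "incenters \<Gamma> = {c}"
      unfolding \<Gamma> incenters_curve by (auto simp: image_iff intro!: exI[of _ "1 :: complex"])
    moreover have "is_circle \<Gamma>" using True is_circle_curve_iff \<Gamma> by simp
    ultimately show ?thesis by auto
  next
    case False
    define a' b' where ab': "a' = (a\<^sup>2 - b\<^sup>2) * (1 + \<mu>) / (2 * a)" "b' = (a\<^sup>2 - b\<^sup>2) * (1 - \<mu>) / (2 * b)"
    have "a\<^sup>2 \<noteq> b\<^sup>2" using False frame by (simp add: power2_eq_iff_nonneg)
    then have nz: "a' \<noteq> 0" "b' \<noteq> 0" using abs_\<mu>_less_1 frame by (auto simp: ab')
    have "incenters \<Gamma> = {p. ((p - c) \<bullet> u)\<^sup>2 / a'\<^sup>2 + ((p - c) \<bullet> v)\<^sup>2 / b'\<^sup>2 = 1}"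
      unfolding \<Gamma> incenters_curve incenter_point_def ab'[symmetric]
      by (rule ellipse_point_image[OF frame(1-3) nz])
    then have "incenters \<Gamma> = {p. ((p - c) \<bullet> u)\<^sup>2 / \<bar>a'\<bar>\<^sup>2 + ((p - c) \<bullet> v)\<^sup>2 / \<bar>b'\<bar>\<^sup>2 = 1}" by simp
    moreover have "0 < \<bar>a'\<bar>" "0 < \<bar>b'\<bar>" using nz by auto
    ultimately have "is_ellipse (incenters \<Gamma>)"
      unfolding is_ellipse_def using frame(1-3) by blast
    then show ?thesis using False by (simp add: \<Gamma> is_circle_curve_iff)
  qed
qed

end
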